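(* Let $n\geq 2$ be an integer. Then $$\sum_{\sigma\in B_n}(-1)^{\ell_B(\sigma)}x^{\mathrm{ofmaj}(\sigma)}y^{\mathrm{odes}(\sigma)}z^{\mathrm{oneg}(\sigma)}=\left\lfloor\tfrac n2\right\rfloor!\,(1-xz)^{\lceil n/2\rceil}\prod_{i=1}^{\lfloor n/2\rfloor}(1-yx^{2i}),$$ and $$\sum_{\sigma\in B_n}(-1)^{\ell_B(\sigma)}x^{\mathrm{efmaj}(\sigma)}y^{\mathrm{edes}(\sigma)}z^{\mathrm{eneg}(\sigma)}=p_{n+1}\left\lfloor\tfrac n2\right\rfloor!\,(1-xz)^{\lfloor n/2\rfloor}\prod_{i=0}^{\lfloor n/2\rfloor}(1-yx^{2i}).$$
   Context: $B_n$ is the hyperoctahedral group: the group of bijections $\sigma$ of $\{-n,\dots,-1,1,\dots,n\}$ with $\sigma(-i)=-\sigma(i)$ for all $i$. For $\sigma\in B_n$ put $\sigma(0)=0$ and let $D(\sigma)=\{i\in\{0,1,\dots,n-1\}:\sigma(i)>\sigma(i+1)\}$ and $\mathrm{Neg}(\sigma)=\{i\in\{1,\dots,n\}:\sigma(i)<0\}$. The Coxeter length is $\ell_B(\sigma)=|\{(i,j):1\le i<j\le n,\ \sigma(i)>\sigma(j)\}|-\sum_{i\in\mathrm{Neg}(\sigma)}\sigma(i)$. For a set $J$ of integers, $J_o$ and $J_e$ denote its subsets of odd, respectively even, elements ($0$ is even). Define $\mathrm{odes}(\sigma)=|D(\sigma)_o|$, $\mathrm{edes}(\sigma)=|D(\sigma)_e|$,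 $\mathrm{omaj}(\sigma)=\sum_{i\in D(\sigma)_o}\frac{i+1}{2}$, $\mathrm{emaj}(\sigma)=\sum_{i\in D(\sigma)_e}\frac{i}{2}$, $\mathrm{oneg}(\sigma)=|\mathrm{Neg}(\sigma)_o|$, $\mathrm{eneg}(\sigma)=|\mathrm{Neg}(\sigma)_e|$, $\mathrm{ofmaj}(\sigma)=2\,\mathrm{omaj}(\sigma)+\mathrm{oneg}(\sigma)$, $\mathrm{efmaj}(\sigma)=2\,\mathrm{emaj}(\sigma)+\mathrm{eneg}(\sigma)$. For an integer $k$, $p_k=(1+(-1)^k)/2$. *)

theory Defs
  imports Complex_Main "HOL-Combinatorics.Permutations"
begin

text \<open>
  An element of the hyperoctahedral group is represented by a total function on the integers that
  is the identity outside \<open>{-n, \<dots>, -1, 1, \<dots>, n}\<close> (this is part of \<open>permutes\<close>). Each group element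
  thus occurs exactly once, and \<open>\<sigma> 0 = 0\<close> holds automatically.
\<close>

definition hyperoctahedral :: "nat \<Rightarrow> (int \<Rightarrow> int) set" where
  "hyperoctahedral n =
     {\<sigma>. \<sigma> permutes ({- int n..int n} - {0}) \<and> (\<forall>i\<in>{- int n..int n} - {0}. \<sigma> (- i) = - \<sigma> i)}"

definition Des :: "nat \<Rightarrow> (int \<Rightarrow> int) \<Rightarrow> nat set" where
  "Des n \<sigma> = {i \<in> {0..<n}. \<sigma> (int i) > \<sigma> (int (i + 1))}"

definition Neg :: "nat \<Rightarrow> (int \<Rightarrow> int) \<Rightarrow> nat set" where
  "Neg n \<sigma> = {i \<in> {1..n}. \<sigma> (int i) < 0}"

text \<open>Every summand over \<open>Neg n \<sigma>\<close> is negative, so \<open>nat\<close> does not truncate here.\<close>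

definition length_B :: "nat \<Rightarrow> (int \<Rightarrow> int) \<Rightarrow> nat" where
  "length_B n \<sigma> =
     nat (int (card {(i, j). 1 \<le> i \<and> i < j \<and> j \<le> n \<and> \<sigma> (int i) > \<sigma> (int j)})
          - (\<Sum>i\<in>Neg n \<sigma>. \<sigma> (int i)))"

definition odd_part :: "nat set \<Rightarrow> nat set" where
  "odd_part J = {i \<in> J. odd i}"

definition even_part :: "nat set \<Rightarrow> nat set" where
  "even_part J = {i \<in> J. even i}"

definition odes :: "nat \<Rightarrow> (int \<Rightarrow> int) \<Rightarrow> nat" where
  "odes n \<sigma> = card (odd_part (Des n \<sigma>))"

definition edes :: "nat \<Rightarrow> (int \<Rightarrow> int) \<Rightarrow> nat" where
  "edes n \<sigma> = card (even_part (Des n \<sigma>))"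

text \<open>In the next two definitions \<open>div\<close> is exact, by the parity of the summation index.\<close>

definition omaj :: "nat \<Rightarrow> (int \<Rightarrow> int) \<Rightarrow> nat" where
  "omaj n \<sigma> = (\<Sum>i\<in>odd_part (Des n \<sigma>). (i + 1) div 2)"

definition emaj :: "nat \<Rightarrow> (int \<Rightarrow> int) \<Rightarrow> nat" where
  "emaj n \<sigma> = (\<Sum>i\<in>even_part (Des n \<sigma>). i div 2)"

definition oneg :: "nat \<Rightarrow> (int \<Rightarrow> int) \<Rightarrow> nat" where
  "oneg n \<sigma> = card (odd_part (Neg n \<sigma>))"

definition eneg :: "nat \<Rightarrow> (int \<Rightarrow> int) \<Rightarrow> nat" where
  "eneg n \<sigma> = card (even_part (Neg n \<sigma>))"

definition ofmaj :: "nat \<Rightarrow> (int \<Rightarrow> int) \<Rightarrow> nat" where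
  "ofmaj n \<sigma> = 2 * omaj n \<sigma> + oneg n \<sigma>"

definition efmaj :: "nat \<Rightarrow> (int \<Rightarrow> int) \<Rightarrow> nat" where
  "efmaj n \<sigma> = 2 * emaj n \<sigma> + eneg n \<sigma>"

text \<open>
  \<open>(1 + (-1)\<^sup>k) / 2\<close>. The division is exact, and the absolute value is harmless since
  \<open>(-1)\<^sup>k\<close> depends only on the parity of \<open>k\<close>. Being an integer, the value can be mapped into any
  commutative ring.
\<close>

definition par :: "int \<Rightarrow> int" where
  "par k = (1 + (-1) ^ nat \<bar>k\<bar>) div 2"

end

theory Submission
  imports Defs
begin

text \<open>
  Both sums are evaluated by the same computation, once for the odd and once for the even
  positions. Write a signed permutation as a permutation \<open>\<tau>\<close> of \<open>{1..n}\<close> together with the set \<open>S\<close>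
  of positions that carry a minus sign. The group has the sign character
  \<open>(-1)^length_B = sign \<tau> * (-1)^card S\<close> (\<open>minus_one_power_length_B\<close>), so the sum can be taken over
  \<open>S\<close> first.

  Let \<open>E\<close> be the set of positions of the chosen parity in \<open>{0..n}\<close>. The statistics only involve
  descents at positions \<open>i \<in> E\<close> and minus signs at positions \<open>i \<in> E\<close>, hence only the restrictions to the
  blocks \<open>{i, i + 1} \<inter> {1..n}\<close>, \<open>i \<in> E\<close>, and these blocks partition \<open>{1..n}\<close>. So for fixed \<open>\<tau>\<close> the sum
  over \<open>S\<close> is a product over the blocks. With \<open>w = x z\<close> for a minus sign and \<open>c\<close> for a descent at \<open>i\<close>, the four
  choices of signs on a full block add up to \<open>1 - c - w + w c = (1 - c) (1 - w)\<close> if \<open>\<tau> i < \<tau> (i + 1)\<close>,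
  and to \<open>c - c - w + w = 0\<close> if \<open>\<tau> i > \<tau> (i + 1)\<close> (\<open>sum_block_weight\<close>). The one-element blocks at
  the two ends give \<open>1 - c\<close> for \<open>i = 0\<close> and \<open>1 - w\<close> for \<open>i = n\<close>.

  All these factors are independent of \<open>\<tau>\<close>, and what is left is the sum of \<open>sign \<tau>\<close> over the permutations
  that ascend inside every full block. Exchanging the two largest values \<open>n - 1\<close> and \<open>n\<close> reverses the sign
  and preserves the ascents, unless these values fill one block. In that case the block can be moved to the end by
  an even permutation and deleted, so the sum is multiplied by the number of blocks when \<open>n\<close> grows by
  two (\<open>sum_sign_ascending_perms_step\<close>), which yields \<open>(n div 2)!\<close>. This needs
  \<open>n - 1\<close> and \<open>n\<close> to form a block; for the odd positions and odd \<open>n\<close>, where \<open>n\<close> is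
  left over, reversal reduces to the case in which \<open>1\<close> is left over. Only for the even positions and even
  \<open>n\<close> are there two unconstrained positions, namely \<open>1\<close> and \<open>n\<close>; exchanging their entries
  shows that the sum is \<open>0\<close>.
\<close>

section \<open>Signed permutations as permutations with a set of minus signs\<close>

text \<open>
  The factor \<open>sgn k\<close> makes the function odd and gives it the value \<open>0\<close> at \<open>0\<close>; outside
  \<open>{-n..n}\<close> it is the identity as soon as \<open>\<tau>\<close> fixes everything outside \<open>{1..n}\<close> and
  \<open>S \<subseteq> {1..n}\<close>.
\<close>

definition signed_perm :: "(nat \<Rightarrow> nat) \<Rightarrow> nat set \<Rightarrow> int \<Rightarrow> int" where
  "signed_perm \<tau> S k = sgn k * (if nat \<bar>k\<bar> \<in> S then - 1 else 1) * int (\<tau> (nat \<bar>k\<bar>))"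

lemma signed_perm_of_nat:
  "0 < i \<Longrightarrow> signed_perm \<tau> S (int i) = (if i \<in> S then - int (\<tau> i) else int (\<tau> i))"
  by (simp add: signed_perm_def)

lemma signed_perm_mem:
  assumes "\<tau> permutes {1..n}" "S \<subseteq> {1..n}"
  shows "signed_perm \<tau> S \<in> hyperoctahedral n"
proof -
  have pos: "\<tau> k \<in> {1..n}" if "k \<in> {1..n}" for k
    using permutes_in_image[OF assms(1)] that by simp
  let ?V = "{- int n..int n} - {0}"
  have abs: "\<bar>signed_perm \<tau> S k\<bar> = int (\<tau> (nat \<bar>k\<bar>))" if "k \<in> ?V" for k
    using that by (simp add: signed_perm_def abs_mult)
  have mem: "nat \<bar>k\<bar> \<in> {1..n}" if "k \<in> ?V" for k
    using that by auto
  have "signed_perm \<tau> S permutes ?V"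
  proof (rule inj_imp_permutes)
    show "inj_on (signed_perm \<tau> S) ?V"
    proof (rule inj_onI)
      fix a b assume a: "a \<in> ?V" and b: "b \<in> ?V" and eq: "signed_perm \<tau> S a = signed_perm \<tau> S b"
      from eq abs[OF a] abs[OF b] have "\<tau> (nat \<bar>a\<bar>) = \<tau> (nat \<bar>b\<bar>)" by simp
      then have ab: "nat \<bar>a\<bar> = nat \<bar>b\<bar>"
        using permutes_inj[OF assms(1)] by (simp add: inj_eq)
      have "\<tau> (nat \<bar>b\<bar>) \<noteq> 0" using pos[OF mem[OF b]] by simp
      with eq ab have "sgn a = sgn b"
        by (auto simp: signed_perm_def split: if_splits)
      with ab show "a = b" by (metis abs_mult_sgn eq_nat_nat_iff abs_ge_zero)
    qed
    show "signed_perm \<tau> S k \<in> ?V" if "k \<in> ?V" for k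
      using pos[OF mem[OF that]] abs[OF that] by auto
    show "signed_perm \<tau> S k = k" if "k \<notin> ?V" for k
    proof (cases "k = 0")
      case False
      then have *: "nat \<bar>k\<bar> \<notin> {1..n}" using that by auto
      then have "\<tau> (nat \<bar>k\<bar>) = nat \<bar>k\<bar>" by (rule permutes_not_in[OF assms(1)])
      then show ?thesis using * assms(2)
        by (auto simp: signed_perm_def subset_iff sgn_mult_abs)
    qed (simp add: signed_perm_def)
  qed auto
  then show ?thesis
    by (simp add: hyperoctahedral_def signed_perm_def)
qed

lemma Neg_signed_perm:
  assumes "\<tau> permutes {1..n}" "S \<subseteq> {1..n}"
  shows "Neg n (signed_perm \<tau> S) = S"
proof -
  have "signed_perm \<tau> S (int i) < 0 \<longleftrightarrow> i \<in> S" if "i \<in> {1..n}" for i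
    using permutes_in_image[OF assms(1), of i] that by (simp add: signed_perm_of_nat)
  then show ?thesis using assms(2) by (auto simp: Neg_def)
qed

lemma bij_betw_signed_perm:
  "bij_betw (\<lambda>(\<tau>, S). signed_perm \<tau> S) ({\<tau>. \<tau> permutes {1..n}} \<times> Pow {1..n}) (hyperoctahedral n)"
proof (rule bij_betw_byWitness[where f' = "\<lambda>\<sigma>. (\<lambda>k. nat \<bar>\<sigma> (int k)\<bar>, Neg n \<sigma>)"])
  show "\<forall>a\<in>{\<tau>. \<tau> permutes {1..n}} \<times> Pow {1..n}.
     (\<lambda>k. nat \<bar>(case a of (\<tau>, S) \<Rightarrow> signed_perm \<tau> S) (int k)\<bar>,
      Neg n (case a of (\<tau>, S) \<Rightarrow> signed_perm \<tau> S)) = a"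
  proof
    fix a :: "(nat \<Rightarrow> nat) \<times> nat set" assume "a \<in> {\<tau>. \<tau> permutes {1..n}} \<times> Pow {1..n}"
    then obtain \<tau> S where a: "a = (\<tau>, S)" and \<tau>: "\<tau> permutes {1..n}" and S: "S \<subseteq> {1..n}"
      by blast
    have "nat \<bar>signed_perm \<tau> S (int k)\<bar> = \<tau> k" for k
      using permutes_not_in[OF \<tau>, of 0] by (cases "k = 0") (simp_all add: signed_perm_def)
    then show "(\<lambda>k. nat \<bar>(case a of (\<tau>, S) \<Rightarrow> signed_perm \<tau> S) (int k)\<bar>,
      Neg n (case a of (\<tau>, S) \<Rightarrow> signed_perm \<tau> S)) = a"
      by (simp add: a Neg_signed_perm[OF \<tau> S])
  qed
  have hyp: "(\<lambda>k. nat \<bar>\<sigma> (int k)\<bar>) permutes {1..n} \<and>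
       signed_perm (\<lambda>k. nat \<bar>\<sigma> (int k)\<bar>) (Neg n \<sigma>) = \<sigma>" if "\<sigma> \<in> hyperoctahedral n" for \<sigma>
  proof -
    let ?V = "{- int n..int n} - {0}"
    from that have p: "\<sigma> permutes ?V" and odd: "\<And>i. i \<in> ?V \<Longrightarrow> \<sigma> (- i) = - \<sigma> i"
      by (auto simp: hyperoctahedral_def)
    have odd': "\<sigma> (- i) = - \<sigma> i" for i
    proof (cases "i \<in> ?V")
      case False
      then show ?thesis using permutes_not_in[OF p, of i] permutes_not_in[OF p, of "- i"] by auto
    qed (rule odd)
    have mem: "\<sigma> i \<in> ?V" if "i \<in> ?V" for i using permutes_in_image[OF p] that by simp
    have inj: "\<sigma> a = \<sigma> b \<Longrightarrow> a = b" for a b using permutes_inj[OF p] by (simp add: inj_eq)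
    have "(\<lambda>k. nat \<bar>\<sigma> (int k)\<bar>) permutes {1..n}"
    proof (rule inj_imp_permutes)
      show "inj_on (\<lambda>k. nat \<bar>\<sigma> (int k)\<bar>) {1..n}"
      proof (rule inj_onI)
        fix a b assume "a \<in> {1..n}" "b \<in> {1..n}" "nat \<bar>\<sigma> (int a)\<bar> = nat \<bar>\<sigma> (int b)\<bar>"
        then have "\<sigma> (int a) = \<sigma> (int b) \<or> \<sigma> (int a) = \<sigma> (- int b)"
          by (auto simp: odd')
        then show "a = b" using inj by fastforce
      qed
      show "nat \<bar>\<sigma> (int k)\<bar> \<in> {1..n}" if "k \<in> {1..n}" for k
        using mem[of "int k"] that by auto
      show "nat \<bar>\<sigma> (int k)\<bar> = k" if "k \<notin> {1..n}" for k
        using permutes_not_in[OF p, of "int k"] that by auto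
    qed simp
    moreover have "signed_perm (\<lambda>k. nat \<bar>\<sigma> (int k)\<bar>) (Neg n \<sigma>) k = \<sigma> k" for k
    proof -
      have nn: "signed_perm (\<lambda>k. nat \<bar>\<sigma> (int k)\<bar>) (Neg n \<sigma>) (int k) = \<sigma> (int k)" for k
      proof (cases "k \<in> {1..n}")
        case True
        then show ?thesis by (auto simp: signed_perm_of_nat Neg_def)
      next
        case False
        then have "\<sigma> (int k) = int k" by (intro permutes_not_in[OF p]) auto
        with False show ?thesis by (auto simp: signed_perm_def Neg_def)
      qed
      show ?thesis
      proof (cases "0 \<le> k")
        case True
        then show ?thesis using nn[of "nat k"] by simp
      next
        case False
        then have k: "k = - int (nat (- k))" by simp
        have "signed_perm \<tau> S (- j) = - signed_perm \<tau> S j" for \<tau> S j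
          by (simp add: signed_perm_def)
        then show ?thesis using nn[of "nat (- k)"] odd' k by metis
      qed
    qed
    ultimately show ?thesis by blast
  qed
  show "\<forall>\<sigma>\<in>hyperoctahedral n.
     (case (\<lambda>k. nat \<bar>\<sigma> (int k)\<bar>, Neg n \<sigma>) of (\<tau>, S) \<Rightarrow> signed_perm \<tau> S) = \<sigma>"
    using hyp by simp
  show "(\<lambda>(\<tau>, S). signed_perm \<tau> S) ` ({\<tau>. \<tau> permutes {1..n}} \<times> Pow {1..n}) \<subseteq> hyperoctahedral n"
    by (auto intro!: signed_perm_mem)
  show "(\<lambda>\<sigma>. (\<lambda>k. nat \<bar>\<sigma> (int k)\<bar>, Neg n \<sigma>)) ` hyperoctahedral n
      \<subseteq> {\<tau>. \<tau> permutes {1..n}} \<times> Pow {1..n}"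
    using hyp by (auto simp: Neg_def)
qed

section \<open>The sign character in terms of the length\<close>

definition index_pairs :: "nat \<Rightarrow> (nat \<times> nat) set" where
  "index_pairs n = {(i, j). 1 \<le> i \<and> i < j \<and> j \<le> n}"

definition inv_sign :: "nat \<Rightarrow> (nat \<Rightarrow> int) \<Rightarrow> int" where
  "inv_sign n f = (\<Prod>(i, j)\<in>index_pairs n. if f i > f j then - 1 else 1)"

lemma finite_index_pairs [simp]: "finite (index_pairs n)"
  by (rule finite_subset[of _ "{1..n} \<times> {1..n}"]) (auto simp: index_pairs_def)

lemma inv_sign_eq_card:
  "inv_sign n f = (- 1) ^ card {(i, j). 1 \<le> i \<and> i < j \<and> j \<le> n \<and> f i > f j}"
proof -
  have "inv_sign n f = (\<Prod>p\<in>index_pairs n. if case p of (i, j) \<Rightarrow> f i > f j then - 1 else 1)"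
    unfolding inv_sign_def by (intro prod.cong) auto
  also have "\<dots> = (- 1) ^ card (index_pairs n \<inter> {p. case p of (i, j) \<Rightarrow> f i > f j})"
    by (subst prod.If_cases) simp_all
  also have "index_pairs n \<inter> {p. case p of (i, j) \<Rightarrow> f i > f j}
      = {(i, j). 1 \<le> i \<and> i < j \<and> j \<le> n \<and> f i > f j}"
    by (auto simp: index_pairs_def)
  finally show ?thesis .
qed

text \<open>
  Exchanging two adjacent values \<open>a\<close> and \<open>a + 1\<close> changes the relative order of one pair only,
  namely of the two positions at which these values occur.
\<close>

lemma inv_sign_adjacent_swap:
  assumes \<tau>: "\<tau> permutes {1..n}" and a: "1 \<le> a" "Suc a \<le> n"
  shows "inv_sign n (\<lambda>i. int ((transpose a (Suc a) \<circ> \<tau>) i)) = - inv_sign n (\<lambda>i. int (\<tau> i))"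
proof -
  define p where "p = inv \<tau> a"
  define q where "q = inv \<tau> (Suc a)"
  have pq: "\<tau> p = a" "\<tau> q = Suc a"
    unfolding p_def q_def using permutes_inverses[OF \<tau>] by auto
  have inj: "\<tau> i = \<tau> j \<longleftrightarrow> i = j" for i j using permutes_inj[OF \<tau>] by (simp add: inj_eq)
  have "p \<in> {1..n}" "q \<in> {1..n}"
    using permutes_in_image[OF \<tau>] pq a by (metis atLeastAtMost_iff Suc_leD le_SucI)+
  moreover have "p \<noteq> q" using pq by auto
  ultimately have mem: "(min p q, max p q) \<in> index_pairs n"
    by (auto simp: index_pairs_def min_def max_def)
  let ?f = "\<lambda>\<pi> (i, j). if int (\<pi> i) > int (\<pi> j) then - 1 else 1 :: int"
  have ne: "?f (transpose a (Suc a) \<circ> \<tau>) x = ?f \<tau> x"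
    if "x \<in> index_pairs n - {(min p q, max p q)}" for x
  proof (cases x)
    case (Pair i j)
    with that have "i < j" by (auto simp: index_pairs_def)
    then have "i \<noteq> j" by simp
    have "\<not> (\<tau> i = a \<and> \<tau> j = Suc a)" "\<not> (\<tau> j = a \<and> \<tau> i = Suc a)"
      using that Pair pq inj \<open>i < j\<close> by (metis DiffD2 max.strict_order_iff max_def min_def nat_less_le singletonI)+
    then show ?thesis
      using inj[of i j] \<open>i \<noteq> j\<close> Pair by (auto simp: transpose_def)
  qed
  have "?f (transpose a (Suc a) \<circ> \<tau>) (min p q, max p q) = - ?f \<tau> (min p q, max p q)"
    using pq by (cases "p \<le> q") (auto simp: min_def max_def)
  then have "prod (?f (transpose a (Suc a) \<circ> \<tau>)) (index_pairs n) = - prod (?f \<tau>) (index_pairs n)"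
    by (simp only: prod.remove[OF finite_index_pairs mem] prod.cong[OF refl ne] mult_minus_left)
  then show ?thesis
    by (simp only: inv_sign_def)
qed

text \<open>
  A transposition \<open>(a b+1)\<close> is \<open>(a b)\<close> conjugated by \<open>(b b+1)\<close>, so one exchange of arbitrary
  values costs an odd number of adjacent exchanges.
\<close>

lemma inv_sign_swap:
  assumes "Suc a \<le> b" "\<tau> permutes {1..n}" and a: "1 \<le> a" "b \<le> n"
  shows "inv_sign n (\<lambda>i. int ((transpose a b \<circ> \<tau>) i)) = - inv_sign n (\<lambda>i. int (\<tau> i))"
  using assms(1,2,4)
proof (induction b arbitrary: \<tau> rule: dec_induct)
  case base
  then show ?case using inv_sign_adjacent_swap[of \<tau> n a] a by simp
next
  case (step b)
  let ?t = "transpose b (Suc b)"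
  have conj: "transpose a (Suc b) = ?t \<circ> (transpose a b \<circ> ?t)"
    using step by (auto simp: transpose_def fun_eq_iff)
  have t: "?t permutes {1..n}" and ab: "transpose a b permutes {1..n}"
    using step a by (auto intro: permutes_swap_id)
  have "inv_sign n (\<lambda>i. int ((transpose a (Suc b) \<circ> \<tau>) i))
      = inv_sign n (\<lambda>i. int ((?t \<circ> (transpose a b \<circ> (?t \<circ> \<tau>))) i))"
    by (simp add: conj comp_assoc)
  also have "\<dots> = - inv_sign n (\<lambda>i. int ((transpose a b \<circ> (?t \<circ> \<tau>)) i))"
    using step a t ab by (intro inv_sign_adjacent_swap permutes_compose) auto
  also have "\<dots> = inv_sign n (\<lambda>i. int ((?t \<circ> \<tau>) i))"
  proof -
    have "?t \<circ> \<tau> permutes {1..n}" using step.prems t by (intro permutes_compose)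
    from step.IH[OF this] step.prems show ?thesis by simp
  qed
  also have "\<dots> = - inv_sign n (\<lambda>i. int (\<tau> i))"
    using step a by (intro inv_sign_adjacent_swap) auto
  finally show ?case .
qed

lemma inv_sign_eq_sign:
  assumes "\<tau> permutes {1..n}"
  shows "inv_sign n (\<lambda>i. int (\<tau> i)) = sign \<tau>"
  using assms finite_atLeastAtMost
proof (induction rule: permutes_induct)
  case id
  then show ?case by (auto simp: inv_sign_def index_pairs_def intro!: prod.neutral)
next
  case (swap a b p)
  have "inv_sign n (\<lambda>i. int ((transpose a b \<circ> p) i)) = - inv_sign n (\<lambda>i. int (p i))"
  proof (cases "a < b")
    case True
    then show ?thesis using swap by (intro inv_sign_swap) auto
  next
    case False
    then have "inv_sign n (\<lambda>i. int ((transpose b a \<circ> p) i)) = - inv_sign n (\<lambda>i. int (p i))"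
      using swap by (intro inv_sign_swap) auto
    then show ?thesis by (simp add: transpose_commute)
  qed
  also have "\<dots> = sign (transpose a b) * sign p"
    using swap by (simp add: sign_swap_id)
  also have "\<dots> = sign (transpose a b \<circ> p)"
    using swap by (intro sign_compose[symmetric] permutation_swap_id)
      (auto intro: permutes_imp_permutation[of "{1..n}"])
  finally show ?case .
qed

text \<open>
  If \<open>a\<close> and \<open>b\<close> have different absolute values, then the sign of \<open>b - a\<close> is the sign of
  \<open>\<bar>b\<bar> - \<bar>a\<bar>\<close> times the sign of the entry with the larger absolute value. The entry
  \<open>\<tau> i\<close> is the larger one in exactly \<open>\<tau> i - 1\<close> pairs, so a minus sign on it contributes
  \<open>(-1)^(\<tau> i - 1)\<close>.
\<close>

lemma inv_sign_signed_perm: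
  assumes \<tau>: "\<tau> permutes {1..n}" and S: "S \<subseteq> {1..n}"
  shows "inv_sign n (\<lambda>i. signed_perm \<tau> S (int i)) = sign \<tau> * (\<Prod>i\<in>S. (- 1) ^ (\<tau> i - 1))"
proof -
  \<comment> \<open>\<open>g\<close> selects from a pair of positions the one with the larger absolute value.\<close>
  define e where "e i = (if i \<in> S then - 1 else 1 :: int)" for i
  define g where "g = (\<lambda>(i, j). if \<tau> i < \<tau> j then j else i)"
  have inj: "\<tau> i = \<tau> j \<longleftrightarrow> i = j" for i j using permutes_inj[OF \<tau>] by (simp add: inj_eq)
  have pos: "\<tau> i \<in> {1..n} \<longleftrightarrow> i \<in> {1..n}" for i using permutes_in_image[OF \<tau>] by simp
  have "inv_sign n (\<lambda>i. signed_perm \<tau> S (int i))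
     = (\<Prod>x\<in>index_pairs n. (case x of (i, j) \<Rightarrow> if int (\<tau> i) > int (\<tau> j) then - 1 else 1) * e (g x))"
    unfolding inv_sign_def
  proof (intro prod.cong refl)
    fix x assume x: "x \<in> index_pairs n"
    obtain i j where ij: "x = (i, j)" by force
    with x have "i < j" "i \<in> {1..n}" "j \<in> {1..n}" by (auto simp: index_pairs_def)
    then show "(case x of (i, j) \<Rightarrow> if signed_perm \<tau> S (int i) > signed_perm \<tau> S (int j) then - 1 else 1)
       = (case x of (i, j) \<Rightarrow> if int (\<tau> i) > int (\<tau> j) then - 1 else 1) * e (g x)"
      using pos[of i] pos[of j] inj[of i j]
      by (auto simp: ij signed_perm_of_nat e_def g_def)
  qed
  also have "\<dots> = sign \<tau> * (\<Prod>x\<in>index_pairs n. e (g x))"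
    using inv_sign_eq_sign[OF \<tau>] by (simp add: prod.distrib inv_sign_def)
  also have "(\<Prod>x\<in>index_pairs n. e (g x))
      = (\<Prod>k\<in>{1..n}. \<Prod>x\<in>{x \<in> index_pairs n. g x = k}. e (g x))"
  proof (rule prod.group[symmetric])
    show "g ` index_pairs n \<subseteq> {1..n}" by (auto simp: g_def index_pairs_def)
  qed simp_all
  also have "\<dots> = (\<Prod>k\<in>{1..n}. e k ^ (\<tau> k - 1))"
  proof (intro prod.cong refl)
    fix k assume k: "k \<in> {1..n}"
    \<comment> \<open>A value \<open>v\<close> below \<open>\<tau> k\<close> is sent to the pair formed by \<open>k\<close> and the position of \<open>v\<close>.\<close>
    have "bij_betw (\<lambda>v. let j = inv \<tau> v in (min j k, max j k)) {1..<\<tau> k} {x \<in> index_pairs n. g x = k}"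
    proof (rule bij_betw_byWitness[where f' = "\<lambda>(i, j). \<tau> (if i = k then j else i)"])
      have mem: "inv \<tau> v \<in> {1..n}" "\<tau> (inv \<tau> v) = v" if "v \<in> {1..<\<tau> k}" for v
        using permutes_in_image[OF permutes_inv[OF \<tau>], of v] permutes_inverses[OF \<tau>] that pos[of k] k
        by auto
      show "\<forall>v\<in>{1..<\<tau> k}. (case let j = inv \<tau> v in (min j k, max j k) of (i, j) \<Rightarrow>
          \<tau> (if i = k then j else i)) = v"
      proof
        fix v assume "v \<in> {1..<\<tau> k}"
        with mem[OF this] have "\<tau> (inv \<tau> v) = v" "inv \<tau> v \<noteq> k" by auto
        then show "(case let j = inv \<tau> v in (min j k, max j k) of (i, j) \<Rightarrow>
          \<tau> (if i = k then j else i)) = v"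
          by (auto simp: Let_def min_def max_def)
      qed
      show "\<forall>x\<in>{x \<in> index_pairs n. g x = k}.
         (let j = inv \<tau> (case x of (i, j) \<Rightarrow> \<tau> (if i = k then j else i)) in (min j k, max j k)) = x"
        using permutes_inverses[OF \<tau>]
        by (auto simp: Let_def g_def index_pairs_def split: if_splits)
      show "(\<lambda>v. let j = inv \<tau> v in (min j k, max j k)) ` {1..<\<tau> k} \<subseteq> {x \<in> index_pairs n. g x = k}"
      proof
        fix x assume "x \<in> (\<lambda>v. let j = inv \<tau> v in (min j k, max j k)) ` {1..<\<tau> k}"
        then obtain v where v: "v \<in> {1..<\<tau> k}" "x = (min (inv \<tau> v) k, max (inv \<tau> v) k)"
          by (auto simp: Let_def)
        with mem[OF v(1)] have "inv \<tau> v \<noteq> k" by auto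
        with v mem[OF v(1)] k show "x \<in> {x \<in> index_pairs n. g x = k}"
          by (auto simp: g_def index_pairs_def min_def max_def)
      qed
      show "(\<lambda>(i, j). \<tau> (if i = k then j else i)) ` {x \<in> index_pairs n. g x = k} \<subseteq> {1..<\<tau> k}"
      proof
        fix v assume "v \<in> (\<lambda>(i, j). \<tau> (if i = k then j else i)) ` {x \<in> index_pairs n. g x = k}"
        then obtain i j where "(i, j) \<in> index_pairs n" "g (i, j) = k" "v = \<tau> (if i = k then j else i)"
          by auto
        then show "v \<in> {1..<\<tau> k}"
          using pos[of i] pos[of j] inj[of i j]
          by (auto simp: g_def index_pairs_def split: if_splits)
      qed
    qed
    from bij_betw_same_card[OF this] show "(\<Prod>x\<in>{x \<in> index_pairs n. g x = k}. e (g x)) = e k ^ (\<tau> k - 1)"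
      by simp
  qed
  also have "\<dots> = (\<Prod>k\<in>{1..n}. if k \<in> S then (- 1) ^ (\<tau> k - 1) else 1)"
    by (intro prod.cong) (auto simp: e_def)
  also have "\<dots> = (\<Prod>i\<in>S. (- 1) ^ (\<tau> i - 1))"
    using S by (simp add: prod.inter_restrict[symmetric] Int_absorb1)
  finally show ?thesis .
qed

text \<open>
  The negative entries add \<open>\<Sum>i\<in>S. \<tau> i\<close> to the length, which combines with the exponents
  \<open>\<tau> i - 1\<close> coming from the inversions to one factor \<open>-1\<close> for each minus sign.
\<close>

lemma minus_one_power_length_B:
  assumes \<tau>: "\<tau> permutes {1..n}" and S: "S \<subseteq> {1..n}"
  shows "(- 1 :: int) ^ length_B n (signed_perm \<tau> S) = sign \<tau> * (- 1) ^ card S"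
proof -
  let ?\<sigma> = "signed_perm \<tau> S"
  let ?I = "{(i, j). 1 \<le> i \<and> i < j \<and> j \<le> n \<and> ?\<sigma> (int i) > ?\<sigma> (int j)}"
  have pos: "\<tau> i \<ge> 1" if "i \<in> S" for i using permutes_in_image[OF \<tau>, of i] that S by auto
  have "(\<Sum>i\<in>S. ?\<sigma> (int i)) = (\<Sum>i\<in>S. - int (\<tau> i))"
    using S by (intro sum.cong) (auto simp: signed_perm_of_nat subset_iff Suc_le_eq)
  then have "length_B n ?\<sigma> = card ?I + (\<Sum>i\<in>S. \<tau> i)"
    by (simp add: length_B_def Neg_signed_perm[OF \<tau> S] sum_negf flip: of_nat_sum of_nat_add)
  then have "(- 1 :: int) ^ length_B n ?\<sigma> = inv_sign n (\<lambda>i. ?\<sigma> (int i)) * (\<Prod>i\<in>S. (- 1) ^ \<tau> i)"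
    by (simp add: power_add power_sum inv_sign_eq_card)
  also have "\<dots> = sign \<tau> * (\<Prod>i\<in>S. (- 1) ^ (\<tau> i - 1) * (- 1) ^ \<tau> i)"
    by (simp add: inv_sign_signed_perm[OF \<tau> S] prod.distrib)
  also have "(\<Prod>i\<in>S. (- 1) ^ (\<tau> i - 1) * (- 1) ^ \<tau> i) = (\<Prod>i\<in>S. - 1 :: int)"
  proof (intro prod.cong refl)
    fix i assume "i \<in> S"
    then obtain m where "\<tau> i = Suc m" using pos[of i] by (cases "\<tau> i") auto
    then show "(- 1 :: int) ^ (\<tau> i - 1) * (- 1) ^ \<tau> i = - 1"
      by (simp flip: power_add mult_2)
  qed
  finally show ?thesis by simp
qed

section \<open>Signed counts of permutations with prescribed ascents\<close>

definition ascending_perms :: "nat \<Rightarrow> nat set \<Rightarrow> (nat \<Rightarrow> nat) set" where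
  "ascending_perms n I = {\<tau>. \<tau> permutes {1..n} \<and> (\<forall>i\<in>I. \<tau> i < \<tau> (Suc i))}"

lemma finite_ascending_perms [simp]: "finite (ascending_perms n I)"
  by (rule finite_subset[OF _ finite_permutations[of "{1..n}"]]) (auto simp: ascending_perms_def)

lemma sign_comp_permutes:
  assumes "finite V" "p permutes V" "q permutes V"
  shows "sign (p \<circ> q) = sign p * sign q"
  using assms by (intro sign_compose) (auto intro: permutes_imp_permutation)

lemma sum_sign_eq_0I:
  assumes inv: "\<And>\<tau>. \<tau> \<in> A \<Longrightarrow> f \<tau> \<in> A" "\<And>\<tau>. \<tau> \<in> A \<Longrightarrow> f (f \<tau>) = \<tau>"
    and "\<And>\<tau>. \<tau> \<in> A \<Longrightarrow> sign (f \<tau>) = - sign \<tau>"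
  shows "(\<Sum>\<tau>\<in>A. sign \<tau>) = 0"
proof -
  have "(\<Sum>\<tau>\<in>A. sign \<tau>) = (\<Sum>\<tau>\<in>A. sign (f \<tau>))"
    using inv by (intro sum.reindex_bij_witness[of _ f f]) auto
  also have "\<dots> = - (\<Sum>\<tau>\<in>A. sign \<tau>)"
    using assms(3) by (simp add: sum_negf)
  finally show ?thesis by simp
qed

text \<open>
  The positions \<open>1\<close> and \<open>n\<close> take part in no prescribed ascent, so exchanging their entries is a
  sign-reversing involution.
\<close>

lemma sum_sign_ascending_perms_unconstrained_ends:
  assumes "2 \<le> n" "1 \<notin> I" "n - 1 \<notin> I" "I \<subseteq> {1..<n}"
  shows "(\<Sum>\<tau>\<in>ascending_perms n I. sign \<tau>) = 0"
proof (rule sum_sign_eq_0I[where f = "\<lambda>\<tau>. \<tau> \<circ> transpose 1 n"])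
  have t: "transpose 1 n permutes {1..n}" using assms by (intro permutes_swap_id) auto
  fix \<tau> assume \<tau>: "\<tau> \<in> ascending_perms n I"
  show "\<tau> \<circ> transpose 1 n \<in> ascending_perms n I"
    unfolding ascending_perms_def
  proof (intro CollectI conjI ballI)
    show "\<tau> \<circ> transpose 1 n permutes {1..n}"
      using \<tau> t by (auto simp: ascending_perms_def intro: permutes_compose)
    fix i assume i: "i \<in> I"
    then have "i \<noteq> 1" "i \<noteq> n" "Suc i \<noteq> 1" "Suc i \<noteq> n" using assms by auto
    with i \<tau> show "(\<tau> \<circ> transpose 1 n) i < (\<tau> \<circ> transpose 1 n) (Suc i)"
      by (simp add: ascending_perms_def)
  qed
  show "\<tau> \<circ> transpose 1 n \<circ> transpose 1 n = \<tau>"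
    by (simp add: comp_assoc)
  have "sign (\<tau> \<circ> transpose 1 n) = sign \<tau> * sign (transpose 1 n)"
    using \<tau> t by (intro sign_comp_permutes[of "{1..n}"]) (auto simp: ascending_perms_def)
  then show "sign (\<tau> \<circ> transpose 1 n) = - sign \<tau>"
    using assms(1) by (simp add: sign_swap_id del: One_nat_def)
qed

text \<open>
  Conjugation with \<open>i \<mapsto> n + 1 - i\<close> preserves the sign. It reverses positions and values at the
  same time, so an ascent at \<open>i\<close> becomes an ascent at \<open>n - i\<close>.
\<close>

lemma sum_sign_ascending_perms_reverse:
  assumes "I \<subseteq> {1..<n}"
  shows "(\<Sum>\<tau>\<in>ascending_perms n ((\<lambda>i. n - i) ` I). sign \<tau>) = (\<Sum>\<tau>\<in>ascending_perms n I. sign \<tau>)"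
proof -
  define \<rho> where "\<rho> i = (if i \<in> {1..n} then n + 1 - i else i)" for i
  have \<rho>\<rho>: "\<rho> (\<rho> i) = i" for i by (auto simp: \<rho>_def)
  have \<rho>: "\<rho> permutes {1..n}"
    by (rule inj_imp_permutes) (auto simp: \<rho>_def inj_on_def)
  have less: "\<rho> b < \<rho> a" if "a < b" "a \<in> {1..n}" "b \<in> {1..n}" for a b
    using that by (auto simp: \<rho>_def)
  have Suc: "\<rho> (Suc i) = n - i" "\<rho> i = Suc (n - i)" if "i \<in> {1..<n}" for i
    using that by (auto simp: \<rho>_def)
  have mem: "\<rho> \<circ> \<tau> \<circ> \<rho> \<in> ascending_perms n ((\<lambda>i. n - i) ` J)"
    if "\<tau> \<in> ascending_perms n J" "J \<subseteq> {1..<n}" for \<tau> J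
    unfolding ascending_perms_def
  proof (intro CollectI conjI ballI)
    have \<tau>: "\<tau> permutes {1..n}" using that by (simp add: ascending_perms_def)
    then show "\<rho> \<circ> \<tau> \<circ> \<rho> permutes {1..n}" by (intro permutes_compose \<rho>)
    fix k assume "k \<in> (\<lambda>i. n - i) ` J"
    then obtain i where i: "i \<in> J" "k = n - i" by blast
    with that have i': "i \<in> {1..<n}" by blast
    then have "n - i \<in> {1..<n}" "n - (n - i) = i" by auto
    then have "\<rho> k = Suc i" "\<rho> (Suc k) = i" using Suc[of k] i by auto
    moreover have "\<tau> i < \<tau> (Suc i)" using that i by (simp add: ascending_perms_def)
    moreover have "\<tau> i \<in> {1..n}" "\<tau> (Suc i) \<in> {1..n}"
      using permutes_in_image[OF \<tau>] i' by auto
    ultimately show "(\<rho> \<circ> \<tau> \<circ> \<rho>) k < (\<rho> \<circ> \<tau> \<circ> \<rho>) (Suc k)"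
      using less by simp
  qed
  have "(\<lambda>i. n - i) ` (\<lambda>i. n - i) ` I = (\<lambda>i. i) ` I"
    unfolding image_image using assms by (intro image_cong) auto
  then have image_twice: "(\<lambda>i. n - i) ` (\<lambda>i. n - i) ` I = I" by simp
  have sub: "(\<lambda>i. n - i) ` I \<subseteq> {1..<n}" using assms by (force simp: subset_iff)
  show ?thesis
  proof (rule sum.reindex_bij_witness[of _ "\<lambda>\<tau>. \<rho> \<circ> \<tau> \<circ> \<rho>" "\<lambda>\<tau>. \<rho> \<circ> \<tau> \<circ> \<rho>"])
    fix \<tau> assume \<tau>: "\<tau> \<in> ascending_perms n ((\<lambda>i. n - i) ` I)"
    show "\<rho> \<circ> \<tau> \<circ> \<rho> \<in> ascending_perms n I" using mem[OF \<tau> sub] by (simp add: image_twice)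
    show "\<rho> \<circ> (\<rho> \<circ> \<tau> \<circ> \<rho>) \<circ> \<rho> = \<tau>" by (simp add: fun_eq_iff \<rho>\<rho>)
    have "\<tau> permutes {1..n}" using \<tau> by (simp add: ascending_perms_def)
    then have "sign (\<rho> \<circ> \<tau> \<circ> \<rho>) = sign \<rho> * sign \<tau> * sign \<rho>"
      using \<rho> by (metis sign_comp_permutes permutes_compose finite_atLeastAtMost)
    then show "sign (\<rho> \<circ> \<tau> \<circ> \<rho>) = sign \<tau>" by simp
  next
    fix \<tau> assume "\<tau> \<in> ascending_perms n I"
    then show "\<rho> \<circ> \<tau> \<circ> \<rho> \<in> ascending_perms n ((\<lambda>i. n - i) ` I)" using mem assms by blast
    show "\<rho> \<circ> (\<rho> \<circ> \<tau> \<circ> \<rho>) \<circ> \<rho> = \<tau>" by (simp add: fun_eq_iff \<rho>\<rho>)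
  qed
qed

text \<open>
  Exchanging the two largest values cancels all permutations for which these values do not occupy a
  pair of positions \<open>k, k + 1\<close> with a prescribed ascent. Permutations for which they do contribute equally
  for every \<open>k\<close>: the last such pair can be interchanged with the pair at \<open>k\<close> by two
  transpositions, which do not affect the sign. For the last pair, the two largest values are fixed and can be
  removed.
\<close>

lemma sum_sign_ascending_perms_step:
  assumes I: "I \<subseteq> {1..<n}" and sep: "\<And>i. i \<in> I \<Longrightarrow> Suc i \<notin> I"
  shows "(\<Sum>\<tau>\<in>ascending_perms (n + 2) (insert (n + 1) I). sign \<tau>)
       = int (card I + 1) * (\<Sum>\<tau>\<in>ascending_perms n I. sign \<tau>)"
proof -
  let ?a = "n + 1" and ?b = "n + 2"
  let ?J = "insert (n + 1) I"
  let ?A = "ascending_perms (n + 2) ?J"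
  \<comment> \<open>\<open>T k\<close> collects the permutations with the two largest values at \<open>k\<close> and \<open>k + 1\<close>.\<close>
  define T where "T k = {\<tau> \<in> ?A. \<tau> k = ?a \<and> \<tau> (Suc k) = ?b}" for k
  have perm: "\<tau> permutes {1..n + 2}" if "\<tau> \<in> ?A" for \<tau>
    using that by (simp add: ascending_perms_def)
  have finI: "finite I" using I by (rule finite_subset) simp
  have JB: "j \<in> {1..n + 1}" if "j \<in> ?J" for j using that I by auto
  have sepJ: "Suc i \<noteq> j" if "i \<in> ?J" "j \<in> ?J" for i j
    using sep that I by (auto simp: subset_iff)
  have inj: "\<tau> i = \<tau> j \<longleftrightarrow> i = j" if "\<tau> \<in> ?A" for \<tau> i j
    using permutes_inj[OF perm[OF that]] by (simp add: inj_eq)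

  have "(\<Sum>\<tau>\<in>?A - (\<Union>k\<in>?J. T k). sign \<tau>) = 0"
  proof (rule sum_sign_eq_0I[where f = "\<lambda>\<tau>. transpose ?a ?b \<circ> \<tau>"])
    have t: "transpose ?a ?b permutes {1..n + 2}" by (intro permutes_swap_id) auto
    fix \<tau> assume \<tau>: "\<tau> \<in> ?A - (\<Union>k\<in>?J. T k)"
    then have p: "\<tau> permutes {1..n + 2}" by (intro perm) simp
    have asc: "\<tau> i < \<tau> (Suc i)" "\<not> (\<tau> i = ?a \<and> \<tau> (Suc i) = ?b)" if "i \<in> ?J" for i
      using that \<tau> by (auto simp: ascending_perms_def T_def)
    have "transpose ?a ?b \<circ> \<tau> \<in> ?A"
      unfolding ascending_perms_def
    proof (intro CollectI conjI ballI)
      show "transpose ?a ?b \<circ> \<tau> permutes {1..n + 2}" using p t by (rule permutes_compose)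
      fix i assume "i \<in> ?J"
      with asc[OF this] show "(transpose ?a ?b \<circ> \<tau>) i < (transpose ?a ?b \<circ> \<tau>) (Suc i)"
        by (auto simp: transpose_def)
    qed
    moreover have "transpose ?a ?b \<circ> \<tau> \<notin> T k" if "k \<in> ?J" for k
    proof
      assume "transpose ?a ?b \<circ> \<tau> \<in> T k"
      then have "\<tau> k = ?b" "\<tau> (Suc k) = ?a" by (auto simp: T_def transpose_def split: if_splits)
      with asc[OF that] show False by simp
    qed
    ultimately show "transpose ?a ?b \<circ> \<tau> \<in> ?A - (\<Union>k\<in>?J. T k)" by blast
    show "transpose ?a ?b \<circ> (transpose ?a ?b \<circ> \<tau>) = \<tau>"
      by (simp flip: comp_assoc)
    have "sign (transpose ?a ?b \<circ> \<tau>) = sign (transpose ?a ?b) * sign \<tau>"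
      using p t by (intro sign_comp_permutes[of "{1..n + 2}"]) auto
    then show "sign (transpose ?a ?b \<circ> \<tau>) = - sign \<tau>" by (simp add: sign_swap_id)
  qed
  moreover have "(\<Union>k\<in>?J. T k) \<subseteq> ?A" by (auto simp: T_def)
  ultimately have "(\<Sum>\<tau>\<in>?A. sign \<tau>) = (\<Sum>\<tau>\<in>(\<Union>k\<in>?J. T k). sign \<tau>)"
    using sum.subset_diff[of "\<Union>k\<in>?J. T k" ?A sign] by (simp only: finite_ascending_perms add_0)
  also have "\<dots> = (\<Sum>k\<in>?J. \<Sum>\<tau>\<in>T k. sign \<tau>)"
  proof (rule sum.UNION_disjoint)
    show "finite ?J" using finI by simp
    show "\<forall>k\<in>?J. finite (T k)" by (auto simp: T_def)
    show "\<forall>k\<in>?J. \<forall>l\<in>?J. k \<noteq> l \<longrightarrow> T k \<inter> T l = {}"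
    proof (intro ballI impI Int_emptyI)
      fix k l \<tau> assume "k \<noteq> l" "\<tau> \<in> T k" "\<tau> \<in> T l"
      then show False using inj[of \<tau> k l] by (simp add: T_def)
    qed
  qed
  also have "\<dots> = (\<Sum>k\<in>?J. \<Sum>\<tau>\<in>ascending_perms n I. sign \<tau>)"
  proof (rule sum.cong[OF refl])
    fix k assume k: "k \<in> ?J"
    define \<pi> where "\<pi> = transpose k ?a \<circ> transpose (Suc k) ?b"
    have \<pi>: "\<pi> permutes {1..n + 2}"
      unfolding \<pi>_def using JB[OF k] by (intro permutes_compose permutes_swap_id) auto
    have ne: "Suc k \<noteq> ?a" using sepJ[OF k, of ?a] by simp
    have \<pi>_simps: "\<pi> k = ?a" "\<pi> (Suc k) = ?b" "\<pi> ?a = k" "\<pi> ?b = Suc k"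
      using ne JB[OF k] by (auto simp: \<pi>_def transpose_def)
    have \<pi>_other: "\<pi> i = i" if "i \<notin> {k, Suc k, ?a, ?b}" for i
      using that by (simp add: \<pi>_def transpose_def)
    have \<pi>\<pi>: "\<pi> (\<pi> i) = i" for i
    proof (cases "i \<in> {k, Suc k, ?a, ?b}")
      case True
      then show ?thesis using \<pi>_simps by (elim insertE emptyE) simp_all
    next
      case False
      from \<pi>_other[OF this] show ?thesis by simp
    qed
    have sign_\<pi>: "sign \<pi> = 1"
      unfolding \<pi>_def using JB[OF k]
      by (subst sign_compose) (auto simp: permutation_swap_id sign_swap_id)
    have \<pi>_J: "\<pi> j \<in> ?J \<and> \<pi> (Suc j) = Suc (\<pi> j)" if "j \<in> ?J" for j
    proof (cases "j \<in> {k, ?a}")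
      case True
      then have "j = k \<or> j = ?a" by simp
      then show ?thesis using \<pi>_simps k by (elim disjE) simp_all
    next
      case False
      then have "j \<notin> {k, Suc k, ?a, ?b}" "Suc j \<notin> {k, Suc k, ?a, ?b}"
        using sepJ[OF k that] sepJ[OF that k] sepJ[OF that, of ?a] JB[OF that] by auto
      then show ?thesis using that \<pi>_other by simp
    qed
    have comp_mem: "\<tau> \<circ> \<pi> \<in> ?A" if "\<tau> \<in> ?A" for \<tau>
      unfolding ascending_perms_def
    proof (intro CollectI conjI ballI)
      show "\<tau> \<circ> \<pi> permutes {1..n + 2}" using \<pi> perm[OF that] by (rule permutes_compose)
      show "(\<tau> \<circ> \<pi>) j < (\<tau> \<circ> \<pi>) (Suc j)" if "j \<in> ?J" for j
        using \<pi>_J[OF that] \<open>\<tau> \<in> ?A\<close> by (auto simp: ascending_perms_def)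
    qed
    have "(\<Sum>\<tau>\<in>T k. sign \<tau>) = (\<Sum>\<tau>\<in>T ?a. sign \<tau>)"
    proof (rule sum.reindex_bij_witness[of _ "\<lambda>\<tau>. \<tau> \<circ> \<pi>" "\<lambda>\<tau>. \<tau> \<circ> \<pi>"])
      fix \<tau> assume \<tau>: "\<tau> \<in> T k"
      then have A: "\<tau> \<in> ?A" by (simp add: T_def)
      show "\<tau> \<circ> \<pi> \<circ> \<pi> = \<tau>" by (simp add: fun_eq_iff \<pi>\<pi>)
      show "\<tau> \<circ> \<pi> \<in> T ?a" using \<tau> comp_mem[OF A] \<pi>_simps by (simp add: T_def)
      show "sign (\<tau> \<circ> \<pi>) = sign \<tau>"
        using sign_comp_permutes[OF _ perm[OF A] \<pi>] sign_\<pi> by simp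
    next
      fix \<tau> assume \<tau>: "\<tau> \<in> T ?a"
      then have A: "\<tau> \<in> ?A" by (simp add: T_def)
      show "\<tau> \<circ> \<pi> \<circ> \<pi> = \<tau>" by (simp add: fun_eq_iff \<pi>\<pi>)
      show "\<tau> \<circ> \<pi> \<in> T k" using \<tau> comp_mem[OF A] \<pi>_simps by (simp add: T_def)
    qed
    also have "T ?a = ascending_perms n I"
    proof (intro equalityI subsetI)
      fix \<tau> assume \<tau>: "\<tau> \<in> T ?a"
      then have p: "\<tau> permutes {1..n + 2}" and fix_ab: "\<tau> ?a = ?a" "\<tau> ?b = ?b"
        using perm by (auto simp: T_def)
      have "\<tau> permutes {1..n}"
      proof (rule permutes_superset[OF p])
        fix i assume "i \<in> {1..n + 2} - {1..n}"
        then have "i = ?a \<or> i = ?b" by auto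
        then show "\<tau> i = i" using fix_ab by auto
      qed
      with \<tau> show "\<tau> \<in> ascending_perms n I" by (auto simp: T_def ascending_perms_def)
    next
      fix \<tau> assume \<tau>: "\<tau> \<in> ascending_perms n I"
      then have p: "\<tau> permutes {1..n}" by (simp add: ascending_perms_def)
      then have "\<tau> ?a = ?a" "\<tau> ?b = ?b" by (auto intro: permutes_not_in)
      moreover have "\<tau> permutes {1..n + 2}" using p by (rule permutes_subset) auto
      ultimately show "\<tau> \<in> T ?a" using \<tau> by (auto simp: T_def ascending_perms_def)
    qed
    finally show "(\<Sum>\<tau>\<in>T k. sign \<tau>) = (\<Sum>\<tau>\<in>ascending_perms n I. sign \<tau>)" .
  qed
  also have "\<dots> = int (card I + 1) * (\<Sum>\<tau>\<in>ascending_perms n I. sign \<tau>)"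
    using finI I by (auto simp: card_insert_if)
  finally show ?thesis .
qed

definition parity_positions :: "nat \<Rightarrow> nat \<Rightarrow> nat set" where
  "parity_positions r n = {i. 1 \<le> i \<and> i < n \<and> even (i + r)}"

lemma card_parity_positions: "card (parity_positions (n + 1) n) = n div 2"
proof (induction n rule: induct_nat_012)
  case (ge2 n)
  have "parity_positions (Suc (Suc n) + 1) (Suc (Suc n)) = insert (n + 1) (parity_positions (n + 1) n)"
    by (auto simp: parity_positions_def less_Suc_eq)
  moreover have "finite (parity_positions (n + 1) n)" "n + 1 \<notin> parity_positions (n + 1) n"
    by (auto simp: parity_positions_def)
  ultimately show ?case using ge2 by simp
qed (simp_all add: parity_positions_def)

text \<open>
  If \<open>i\<close> runs over the positions whose parity is opposite to that of \<open>n\<close>, then \<open>n - 1\<close> is one of them,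
  and the positions for \<open>n + 2\<close> arise from those for \<open>n\<close> by adding \<open>n + 1\<close>. This is the
  situation of the recursion above.
\<close>

lemma sum_sign_parity_positions_opposite:
  "(\<Sum>\<tau>\<in>ascending_perms n (parity_positions (n + 1) n). sign \<tau>) = fact (n div 2)"
proof (induction n rule: induct_nat_012)
  case 0
  have "ascending_perms 0 (parity_positions (0 + 1) 0) = {id}"
    by (auto simp: ascending_perms_def parity_positions_def)
  then show ?case by simp
next
  case 1
  have "ascending_perms (Suc 0) (parity_positions (Suc 0 + 1) (Suc 0)) = {id}"
    by (auto simp: ascending_perms_def parity_positions_def)
  then show ?case by simp
next
  case (ge2 n)
  have "parity_positions (Suc (Suc n) + 1) (Suc (Suc n)) = insert (n + 1) (parity_positions (n + 1) n)"
    by (auto simp: parity_positions_def less_Suc_eq)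
  then have "(\<Sum>\<tau>\<in>ascending_perms (Suc (Suc n)) (parity_positions (Suc (Suc n) + 1) (Suc (Suc n))). sign \<tau>)
      = (\<Sum>\<tau>\<in>ascending_perms (n + 2) (insert (n + 1) (parity_positions (n + 1) n)). sign \<tau>)"
    by simp
  also have "\<dots> = int (card (parity_positions (n + 1) n) + 1) * (\<Sum>\<tau>\<in>ascending_perms n (parity_positions (n + 1) n). sign \<tau>)"
    by (rule sum_sign_ascending_perms_step) (auto simp: parity_positions_def)
  also have "\<dots> = fact (Suc (Suc n) div 2)"
    by (simp only: card_parity_positions ge2) simp
  finally show ?case .
qed

text \<open>
  For odd \<open>n\<close> the unpaired position is the last one; reversal makes it the first one, which is the
  case already treated.
\<close>

lemma sum_sign_odd_positions:
  "(\<Sum>\<tau>\<in>ascending_perms n (parity_positions 1 n). sign \<tau>) = fact (n div 2)"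
proof (cases "even n")
  case True
  then have "parity_positions 1 n = parity_positions (n + 1) n" by (auto simp: parity_positions_def)
  then show ?thesis using sum_sign_parity_positions_opposite by simp
next
  case False
  have "parity_positions 1 n = (\<lambda>i. n - i) ` parity_positions (n + 1) n"
  proof (intro equalityI subsetI)
    fix i assume "i \<in> parity_positions 1 n"
    then have "i = n - (n - i)" "n - i \<in> parity_positions (n + 1) n" using False by (auto simp: parity_positions_def)
    then show "i \<in> (\<lambda>i. n - i) ` parity_positions (n + 1) n" by blast
  qed (use False in \<open>auto simp: parity_positions_def\<close>)
  moreover have "parity_positions (n + 1) n \<subseteq> {1..<n}" by (auto simp: parity_positions_def)
  ultimately show ?thesis
    using sum_sign_ascending_perms_reverse sum_sign_parity_positions_opposite by simp
qed

lemma sum_sign_even_positions: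
  assumes "n \<ge> 1"
  shows "(\<Sum>\<tau>\<in>ascending_perms n (parity_positions 0 n). sign \<tau>) = (if even n then 0 else fact (n div 2))"
proof (cases "even n")
  case True
  with assms have "2 \<le> n" by presburger
  with True have "(\<Sum>\<tau>\<in>ascending_perms n (parity_positions 0 n). sign \<tau>) = 0"
    by (intro sum_sign_ascending_perms_unconstrained_ends) (auto simp: parity_positions_def)
  with True show ?thesis by simp
next
  case False
  then have "parity_positions 0 n = parity_positions (n + 1) n" by (auto simp: parity_positions_def)
  with False show ?thesis using sum_sign_parity_positions_opposite by simp
qed

section \<open>Summation over the minus signs, block by block\<close>

lemma sum_Pow_Un_disjoint:
  assumes "A \<inter> B = {}"
  shows "(\<Sum>S\<in>Pow (A \<union> B). F S) = (\<Sum>T\<in>Pow A. \<Sum>U\<in>Pow B. F (T \<union> U))"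
proof -
  have "(\<Sum>S\<in>Pow (A \<union> B). F S) = (\<Sum>(T, U)\<in>Pow A \<times> Pow B. F (T \<union> U))"
    by (rule sum.reindex_bij_witness[of _ "\<lambda>(T, U). T \<union> U" "\<lambda>S. (S \<inter> A, S \<inter> B)"])
      (use assms in \<open>auto intro!: arg_cong[of _ _ F]\<close>)
  then show ?thesis by (simp add: sum.cartesian_product)
qed

lemma sum_Pow_UNION_prod:
  fixes g :: "'i \<Rightarrow> 'b set \<Rightarrow> 'a :: comm_semiring_1"
  assumes "finite E" "disjoint_family_on B E"
  shows "(\<Sum>S\<in>Pow (\<Union>i\<in>E. B i). \<Prod>i\<in>E. g i (S \<inter> B i)) = (\<Prod>i\<in>E. \<Sum>T\<in>Pow (B i). g i T)"
  using assms
proof (induction E rule: finite_induct)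
  case (insert k E)
  let ?U = "\<Union>i\<in>E. B i"
  have disj: "B k \<inter> ?U = {}"
    using insert.prems insert.hyps by (auto simp: disjoint_family_on_def)
  have "(\<Sum>S\<in>Pow (\<Union>i\<in>insert k E. B i). \<Prod>i\<in>insert k E. g i (S \<inter> B i))
      = (\<Sum>T\<in>Pow (B k). \<Sum>S\<in>Pow ?U. \<Prod>i\<in>insert k E. g i ((T \<union> S) \<inter> B i))"
    by (simp only: UN_insert sum_Pow_Un_disjoint[OF disj])
  also have "\<dots> = (\<Sum>T\<in>Pow (B k). \<Sum>S\<in>Pow ?U. g k T * (\<Prod>i\<in>E. g i (S \<inter> B i)))"
  proof (intro sum.cong refl)
    fix T S assume T: "T \<in> Pow (B k)" and S: "S \<in> Pow ?U"
    have "(T \<union> S) \<inter> B k = T" using T S disj by auto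
    moreover have "(T \<union> S) \<inter> B i = S \<inter> B i" if "i \<in> E" for i using T that disj by auto
    ultimately show "(\<Prod>i\<in>insert k E. g i ((T \<union> S) \<inter> B i)) = g k T * (\<Prod>i\<in>E. g i (S \<inter> B i))"
      using insert.hyps by simp
  qed
  also have "\<dots> = (\<Sum>T\<in>Pow (B k). g k T) * (\<Sum>S\<in>Pow ?U. \<Prod>i\<in>E. g i (S \<inter> B i))"
    by (simp add: sum_product)
  also have "(\<Sum>S\<in>Pow ?U. \<Prod>i\<in>E. g i (S \<inter> B i)) = (\<Prod>i\<in>E. \<Sum>T\<in>Pow (B i). g i T)"
    using insert.prems by (intro insert.IH) (auto simp: disjoint_family_on_def)
  finally show ?case using insert.hyps by simp
qed simp

definition block :: "nat \<Rightarrow> nat \<Rightarrow> nat set" where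
  "block n i = {i, Suc i} \<inter> {1..n}"

text \<open>
  The set \<open>T\<close> stands for the minus signs inside the block at \<open>i\<close>. Since it determines the entries at
  \<open>i\<close> and \<open>i + 1\<close>, the weight of a whole signed permutation is the product of its block weights.
\<close>

definition block_weight :: "nat \<Rightarrow> 'a :: comm_ring_1 \<Rightarrow> 'a \<Rightarrow> (nat \<Rightarrow> nat) \<Rightarrow> nat \<Rightarrow> nat set \<Rightarrow> 'a" where
  "block_weight n w c \<tau> i T = (- 1) ^ card T * (if i \<in> T then w else 1) *
     (if i < n \<and> signed_perm \<tau> T (int i) > signed_perm \<tau> T (int (i + 1)) then c else 1)"

text \<open>
  Changing the sign of the entry of smaller absolute value never affects a descent at \<open>i\<close>. If the smaller
  entry is the second one, this cancels everything. If it is the first one, its sign contributes \<open>1 - w\<close>, and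
  the sign of the larger second entry alone decides whether there is a descent, which contributes
  \<open>1 - c\<close>. At \<open>i = 0\<close> the first entry is the constant \<open>0\<close>, so only the factor \<open>1 - c\<close>
  remains; at \<open>i = n\<close> there is no second entry.
\<close>

lemma sum_block_weight:
  fixes w c :: "'a :: comm_ring_1"
  assumes \<tau>: "\<tau> permutes {1..n}" and i: "i \<le> n" "1 \<le> n"
  shows "(\<Sum>T\<in>Pow (block n i). block_weight n w c \<tau> i T)
       = (if 1 \<le> i then 1 - w else 1) * (if i < n then (1 - c) * of_bool (\<tau> i < \<tau> (Suc i)) else 1)"
proof -
  have pos: "\<tau> k \<ge> 1" if "k \<in> {1..n}" for k using permutes_in_image[OF \<tau>, of k] that by simp
  have t0: "\<tau> 0 = 0" using permutes_not_in[OF \<tau>, of 0] by simp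
  consider (first) "i = 0" | (last) "i = n" | (inner) "1 \<le> i" "i < n" using i by linarith
  then show ?thesis
  proof cases
    case first
    then have "Pow (block n i) = {{}, {1}}" using i by (auto simp: block_def Pow_insert)
    with first pos[of 1] t0 i show ?thesis
      by (auto simp: block_weight_def signed_perm_def)
  next
    case last
    then have "Pow (block n i) = {{}, {n}}" using i by (auto simp: block_def Pow_insert)
    with last i show ?thesis by (auto simp: block_weight_def)
  next
    case inner
    then have "block n i = {i, Suc i}" by (auto simp: block_def)
    then have "Pow (block n i) = {{}, {i}, {Suc i}, {i, Suc i}}" by (auto simp: Pow_insert)
    moreover have "{i} \<noteq> {i, Suc i}" "{Suc i} \<noteq> {i, Suc i}" by auto
    moreover have "\<tau> i \<noteq> \<tau> (Suc i)" using permutes_inj[OF \<tau>] by (simp add: inj_eq)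
    ultimately show ?thesis using inner pos[of i] pos[of "Suc i"]
      by (auto simp: block_weight_def signed_perm_of_nat signed_perm_of_nat[of "Suc i", simplified] algebra_simps)
  qed
qed

lemma blocks_partition:
  "(\<Union>i\<in>{i. i \<le> n \<and> even (i + r)}. block n i) = {1..n}"
  "disjoint_family_on (block n) {i. i \<le> n \<and> even (i + r)}"
proof -
  show "(\<Union>i\<in>{i. i \<le> n \<and> even (i + r)}. block n i) = {1..n}"
  proof (intro equalityI subsetI)
    fix k assume k: "k \<in> {1..n}"
    show "k \<in> (\<Union>i\<in>{i. i \<le> n \<and> even (i + r)}. block n i)"
    proof (cases "even (k + r)")
      case True
      with k show ?thesis by (auto simp: block_def)
    next
      case False
      with k have "k - 1 \<le> n \<and> even (k - 1 + r)" "k \<in> block n (k - 1)"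
        by (auto simp: block_def)
      then show ?thesis by blast
    qed
  qed (auto simp: block_def)
  show "disjoint_family_on (block n) {i. i \<le> n \<and> even (i + r)}"
    by (auto simp: disjoint_family_on_def block_def)
qed

lemma signed_perm_weight_eq_prod_block_weight:
  fixes w :: "'a :: comm_ring_1" and c :: "nat \<Rightarrow> 'a"
  assumes \<tau>: "\<tau> permutes {1..n}" and S: "S \<subseteq> {1..n}" and E: "E = {i. i \<le> n \<and> even (i + r)}"
  shows "(- 1) ^ card S * (\<Prod>i\<in>Des n (signed_perm \<tau> S) \<inter> E. c i) * w ^ card (S \<inter> E)
       = (\<Prod>i\<in>E. block_weight n w (c i) \<tau> i (S \<inter> block n i))"
proof -
  have finE: "finite E" using E by simp
  have finS: "finite S" using S finite_subset by blast
  have "S = (\<Union>i\<in>E. S \<inter> block n i)"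
    using blocks_partition(1)[of n r] S E by auto
  then have "card S = (\<Sum>i\<in>E. card (S \<inter> block n i))"
    using blocks_partition(2)[of n r] E finE finS
    by (subst \<open>S = _\<close>, intro card_UN_disjoint) (auto simp: disjoint_family_on_def)
  then have sgn: "(- 1 :: 'a) ^ card S = (\<Prod>i\<in>E. (- 1) ^ card (S \<inter> block n i))"
    by (simp add: power_sum)
  have mem: "i \<in> S \<inter> block n i \<longleftrightarrow> i \<in> S" for i
    using S by (auto simp: block_def)
  have "(\<Prod>i\<in>E. if i \<in> S then w else 1) = w ^ card (S \<inter> E)"
    using finE by (simp add: prod.If_cases Int_commute)
  moreover have "(\<Prod>i\<in>Des n (signed_perm \<tau> S) \<inter> E. c i)
      = (\<Prod>i\<in>E. if i < n \<and> signed_perm \<tau> (S \<inter> block n i) (int i)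
             > signed_perm \<tau> (S \<inter> block n i) (int (i + 1)) then c i else 1)"
  proof -
    have "signed_perm \<tau> (S \<inter> block n i) (int i) = signed_perm \<tau> S (int i)"
      "signed_perm \<tau> (S \<inter> block n i) (int (i + 1)) = signed_perm \<tau> S (int (i + 1))" if "i < n" for i
      using that S by (auto simp: signed_perm_def block_def nat_add_distrib)
    then show ?thesis
      using finE by (subst Int_commute) (auto simp: prod.inter_restrict Des_def intro!: prod.cong)
  qed
  ultimately show ?thesis
    by (simp add: sgn block_weight_def prod.distrib mem mult_ac del: Int_iff of_nat_add)
qed

text \<open>
  The common form of the two identities: the positions in \<open>E\<close> are those of the parity of \<open>r\<close>, \<open>w\<close>
  records the minus signs and \<open>c i\<close> a descent at \<open>i\<close>. Position \<open>0\<close> never carries a minus sign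
  and position \<open>n\<close> is never a descent, hence the sets \<open>E - {0}\<close> and \<open>E - {n}\<close>.
\<close>

lemma sum_hyperoctahedral_parity_class:
  fixes w :: "'a :: comm_ring_1" and c :: "nat \<Rightarrow> 'a"
  assumes n: "1 \<le> n" and E: "E = {i. i \<le> n \<and> even (i + r)}"
  shows "(\<Sum>\<sigma>\<in>hyperoctahedral n.
            (- 1) ^ length_B n \<sigma> * (\<Prod>i\<in>Des n \<sigma> \<inter> E. c i) * w ^ card (Neg n \<sigma> \<inter> E))
       = (1 - w) ^ card (E - {0}) * (\<Prod>i\<in>E - {n}. 1 - c i) *
           of_int (\<Sum>\<tau>\<in>ascending_perms n (parity_positions r n). sign \<tau>)"
proof -
  have finE: "finite E" using E by simp
  let ?P = "{\<tau>. \<tau> permutes {1..n}}"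
  let ?F = "\<lambda>\<sigma>. (- 1 :: 'a) ^ length_B n \<sigma> * (\<Prod>i\<in>Des n \<sigma> \<inter> E. c i) * w ^ card (Neg n \<sigma> \<inter> E)"
  have U: "(\<Union>i\<in>E. block n i) = {1..n}" and disj: "disjoint_family_on (block n) E"
    using blocks_partition E by auto
  have "sum ?F (hyperoctahedral n) = (\<Sum>(\<tau>, S)\<in>?P \<times> Pow {1..n}. ?F (signed_perm \<tau> S))"
    by (subst sum.reindex_bij_betw[OF bij_betw_signed_perm, symmetric]) (simp add: case_prod_unfold)
  also have "\<dots> = (\<Sum>\<tau>\<in>?P. \<Sum>S\<in>Pow {1..n}. ?F (signed_perm \<tau> S))"
    by (rule sum.cartesian_product[symmetric])
  also have "\<dots> = (\<Sum>\<tau>\<in>?P. of_int (sign \<tau>) *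
      (\<Sum>S\<in>Pow (\<Union>i\<in>E. block n i). \<Prod>i\<in>E. block_weight n w (c i) \<tau> i (S \<inter> block n i)))"
  proof -
    have "?F (signed_perm \<tau> S) = of_int (sign \<tau>) * (\<Prod>i\<in>E. block_weight n w (c i) \<tau> i (S \<inter> block n i))"
      if "\<tau> permutes {1..n}" "S \<subseteq> {1..n}" for \<tau> S
    proof -
      have "(- 1 :: 'a) ^ length_B n (signed_perm \<tau> S)
          = of_int ((- 1) ^ length_B n (signed_perm \<tau> S))"
        by simp
      also have "\<dots> = of_int (sign \<tau>) * (- 1) ^ card S"
        by (simp only: minus_one_power_length_B[OF that]) simp
      finally show ?thesis
        unfolding signed_perm_weight_eq_prod_block_weight[OF that E, symmetric]
        by (simp only: Neg_signed_perm[OF that] mult.assoc)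
    qed
    then show ?thesis
      unfolding U by (intro sum.cong refl) (simp add: sum_distrib_left)
  qed
  also have "\<dots> = (\<Sum>\<tau>\<in>?P. of_int (sign \<tau>) *
      ((1 - w) ^ card (E - {0}) * (\<Prod>i\<in>E - {n}. 1 - c i) * of_bool (\<forall>i\<in>parity_positions r n. \<tau> i < \<tau> (Suc i))))"
  proof (intro sum.cong refl arg_cong2[of _ _ _ _ "(*)"])
    fix \<tau> assume "\<tau> \<in> ?P"
    then have \<tau>: "\<tau> permutes {1..n}" by simp
    \<comment> \<open>The block at \<open>0\<close> imposes no condition on \<open>\<tau>\<close>.\<close>
    have asc0: "\<tau> 0 < \<tau> (Suc 0)"
      using permutes_not_in[OF \<tau>, of 0] permutes_in_image[OF \<tau>, of 1] n by simp
    have "(\<Sum>S\<in>Pow (\<Union>i\<in>E. block n i). \<Prod>i\<in>E. block_weight n w (c i) \<tau> i (S \<inter> block n i))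
        = (\<Prod>i\<in>E. \<Sum>T\<in>Pow (block n i). block_weight n w (c i) \<tau> i T)"
      by (rule sum_Pow_UNION_prod[OF finE disj])
    also have "\<dots> = (\<Prod>i\<in>E. (if 1 \<le> i then 1 - w else 1) *
        ((if i < n then 1 - c i else 1) * (if i < n then of_bool (\<tau> i < \<tau> (Suc i)) else 1)))"
      using E n by (intro prod.cong refl) (simp add: sum_block_weight[OF \<tau>])
    also have "\<dots> = (\<Prod>i\<in>E. if 1 \<le> i then 1 - w else 1) * ((\<Prod>i\<in>E. if i < n then 1 - c i else 1) *
        (\<Prod>i\<in>E. if i < n then of_bool (\<tau> i < \<tau> (Suc i)) else 1))"
      by (simp only: prod.distrib)
    also have "(\<Prod>i\<in>E. if 1 \<le> i then 1 - w else 1) = (1 - w) ^ card (E - {0})"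
    proof -
      have "E \<inter> {i. 1 \<le> i} = E - {0}" by auto
      then show ?thesis using finE by (simp add: prod.If_cases)
    qed
    also have "(\<Prod>i\<in>E. if i < n then 1 - c i else 1) = (\<Prod>i\<in>E - {n}. 1 - c i)"
    proof -
      have "E \<inter> {i. i < n} = E - {n}" using E by auto
      then show ?thesis using finE by (simp add: prod.If_cases)
    qed
    also have "(\<Prod>i\<in>E. if i < n then of_bool (\<tau> i < \<tau> (Suc i)) else 1)
        = (of_bool (\<forall>i\<in>parity_positions r n. \<tau> i < \<tau> (Suc i)) :: 'a)"
    proof (cases "\<forall>i\<in>parity_positions r n. \<tau> i < \<tau> (Suc i)")
      case True
      have "\<tau> i < \<tau> (Suc i)" if "i \<in> E" "i < n" for i
        using that True asc0 E by (cases "i = 0") (auto simp: parity_positions_def)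
      with True show ?thesis by (auto intro!: prod.neutral)
    next
      case False
      then obtain i where "i \<in> parity_positions r n" "\<not> \<tau> i < \<tau> (Suc i)" by blast
      then have "\<exists>i\<in>E. (if i < n then of_bool (\<tau> i < \<tau> (Suc i)) else 1 :: 'a) = 0"
        using E by (intro bexI[of _ i]) (auto simp: parity_positions_def)
      with False finE show ?thesis by (auto intro: prod_zero)
    qed
    finally show "(\<Sum>S\<in>Pow (\<Union>i\<in>E. block n i). \<Prod>i\<in>E. block_weight n w (c i) \<tau> i (S \<inter> block n i))
      = (1 - w) ^ card (E - {0}) * (\<Prod>i\<in>E - {n}. 1 - c i) * of_bool (\<forall>i\<in>parity_positions r n. \<tau> i < \<tau> (Suc i))"
      by (simp only: mult.assoc)
  qed
  also have "\<dots> = (1 - w) ^ card (E - {0}) * (\<Prod>i\<in>E - {n}. 1 - c i) *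
      (\<Sum>\<tau>\<in>?P. if \<forall>i\<in>parity_positions r n. \<tau> i < \<tau> (Suc i) then of_int (sign \<tau>) else 0)"
    unfolding sum_distrib_left by (intro sum.cong refl) simp
  also have "(\<Sum>\<tau>\<in>?P. if \<forall>i\<in>parity_positions r n. \<tau> i < \<tau> (Suc i) then of_int (sign \<tau>) else 0)
      = (\<Sum>\<tau>\<in>ascending_perms n (parity_positions r n). of_int (sign \<tau>) :: 'a)"
    by (subst sum.inter_filter[symmetric]) (simp_all add: finite_permutations ascending_perms_def)
  finally show ?thesis by simp
qed

lemma card_odd_le: "card {i::nat. i \<le> n \<and> odd i} = (n + 1) div 2"
proof (induction n)
  case 0
  have "{i::nat. i \<le> 0 \<and> odd i} = {}" by (auto dest: odd_pos)
  then show ?case by simp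
next
  case (Suc n)
  have "{i. i \<le> Suc n \<and> odd i} = {i. i \<le> n \<and> odd i} \<union> (if odd (Suc n) then {Suc n} else {})"
    by (auto simp: le_Suc_eq)
  with Suc show ?case by auto
qed

lemma card_even_le: "card ({i::nat. i \<le> n \<and> even i} - {0}) = n div 2"
proof (induction n)
  case 0
  have "{i::nat. i \<le> 0 \<and> even i} - {0} = {}" by auto
  then show ?case by (simp only: card.empty)
next
  case (Suc n)
  have "{i. i \<le> Suc n \<and> even i} - {0} = ({i. i \<le> n \<and> even i} - {0}) \<union> (if even (Suc n) then {Suc n} else {})"
    by (auto simp: le_Suc_eq)
  with Suc show ?case by auto
qed

lemma of_int_fact_eq_of_nat: "of_int (fact k) = (of_nat (fact k) :: 'a :: comm_ring_1)"
  by (metis of_int_of_nat_eq of_nat_fact)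

theorem corollary4p10:
  fixes n :: nat and x y z :: "'a :: comm_ring_1"
  assumes "n \<ge> 2"
  shows "(\<Sum>\<sigma>\<in>hyperoctahedral n.
            (-1) ^ length_B n \<sigma> * x ^ ofmaj n \<sigma> * y ^ odes n \<sigma> * z ^ oneg n \<sigma>)
         = of_nat (fact (n div 2)) * (1 - x * z) ^ nat \<lceil>real n / 2\<rceil>
           * (\<Prod>i=1..n div 2. 1 - y * x ^ (2 * i))
       \<and> (\<Sum>\<sigma>\<in>hyperoctahedral n.
            (-1) ^ length_B n \<sigma> * x ^ efmaj n \<sigma> * y ^ edes n \<sigma> * z ^ eneg n \<sigma>)
         = of_int (par (int n + 1)) * of_nat (fact (n div 2)) * (1 - x * z) ^ (n div 2)
           * (\<Prod>i=0..n div 2. 1 - y * x ^ (2 * i))"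
proof
  let ?O = "{i. i \<le> n \<and> even (i + 1)}"
  have "(- 1) ^ length_B n \<sigma> * x ^ ofmaj n \<sigma> * y ^ odes n \<sigma> * z ^ oneg n \<sigma>
      = (- 1) ^ length_B n \<sigma> * (\<Prod>i\<in>Des n \<sigma> \<inter> ?O. y * x ^ (i + 1)) * (x * z) ^ card (Neg n \<sigma> \<inter> ?O)"
    for \<sigma>
  proof -
    have D: "Des n \<sigma> \<inter> ?O = odd_part (Des n \<sigma>)" and N: "Neg n \<sigma> \<inter> ?O = odd_part (Neg n \<sigma>)"
      by (auto simp: odd_part_def Des_def Neg_def)
    have "2 * omaj n \<sigma> = (\<Sum>i\<in>odd_part (Des n \<sigma>). i + 1)"
      unfolding omaj_def sum_distrib_left by (intro sum.cong) (auto simp: odd_part_def)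
    then have descents: "(\<Prod>i\<in>Des n \<sigma> \<inter> ?O. y * x ^ (i + 1)) = y ^ odes n \<sigma> * x ^ (2 * omaj n \<sigma>)"
      by (simp only: D prod.distrib prod_constant odes_def power_sum)
    have negatives: "(x * z) ^ card (Neg n \<sigma> \<inter> ?O) = x ^ oneg n \<sigma> * z ^ oneg n \<sigma>"
      by (simp only: N oneg_def power_mult_distrib)
    show ?thesis
      unfolding descents negatives by (simp add: ofmaj_def power_add mult_ac)
  qed
  then have "(\<Sum>\<sigma>\<in>hyperoctahedral n. (- 1) ^ length_B n \<sigma> * x ^ ofmaj n \<sigma> * y ^ odes n \<sigma> * z ^ oneg n \<sigma>)
      = (1 - x * z) ^ card (?O - {0}) * (\<Prod>i\<in>?O - {n}. 1 - y * x ^ (i + 1)) * of_int (fact (n div 2))"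
    using sum_hyperoctahedral_parity_class[of n ?O 1 "\<lambda>i. y * x ^ (i + 1)" "x * z"] assms
    by (simp only: sum_sign_odd_positions)
  moreover have "card (?O - {0}) = nat \<lceil>real n / 2\<rceil>"
  proof -
    have "?O - {0} = {i. i \<le> n \<and> odd i}" by auto
    moreover have "nat \<lceil>real n / 2\<rceil> = (n + 1) div 2" by linarith
    ultimately show ?thesis by (simp add: card_odd_le)
  qed
  moreover have "(\<Prod>i\<in>?O - {n}. 1 - y * x ^ (i + 1)) = (\<Prod>i=1..n div 2. 1 - y * x ^ (2 * i))"
    by (rule prod.reindex_bij_witness[of _ "\<lambda>j. 2 * j - 1" "\<lambda>i. (i + 1) div 2"]) (auto, presburger)
  ultimately show "(\<Sum>\<sigma>\<in>hyperoctahedral n. (-1) ^ length_B n \<sigma> * x ^ ofmaj n \<sigma> * y ^ odes n \<sigma> * z ^ oneg n \<sigma>)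
      = of_nat (fact (n div 2)) * (1 - x * z) ^ nat \<lceil>real n / 2\<rceil> * (\<Prod>i=1..n div 2. 1 - y * x ^ (2 * i))"
    by (simp add: of_int_fact_eq_of_nat mult_ac del: of_nat_fact)
next
  let ?E = "{i. i \<le> n \<and> even (i + 0)}"
  have "(- 1) ^ length_B n \<sigma> * x ^ efmaj n \<sigma> * y ^ edes n \<sigma> * z ^ eneg n \<sigma>
      = (- 1) ^ length_B n \<sigma> * (\<Prod>i\<in>Des n \<sigma> \<inter> ?E. y * x ^ i) * (x * z) ^ card (Neg n \<sigma> \<inter> ?E)"
    for \<sigma>
  proof -
    have D: "Des n \<sigma> \<inter> ?E = even_part (Des n \<sigma>)" and N: "Neg n \<sigma> \<inter> ?E = even_part (Neg n \<sigma>)"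
      by (auto simp: even_part_def Des_def Neg_def)
    have "2 * emaj n \<sigma> = (\<Sum>i\<in>even_part (Des n \<sigma>). i)"
      unfolding emaj_def sum_distrib_left by (intro sum.cong) (auto simp: even_part_def)
    then have descents: "(\<Prod>i\<in>Des n \<sigma> \<inter> ?E. y * x ^ i) = y ^ edes n \<sigma> * x ^ (2 * emaj n \<sigma>)"
      by (simp only: D prod.distrib prod_constant edes_def power_sum)
    have negatives: "(x * z) ^ card (Neg n \<sigma> \<inter> ?E) = x ^ eneg n \<sigma> * z ^ eneg n \<sigma>"
      by (simp only: N eneg_def power_mult_distrib)
    show ?thesis
      unfolding descents negatives by (simp add: efmaj_def power_add mult_ac)
  qed
  then have *: "(\<Sum>\<sigma>\<in>hyperoctahedral n. (- 1) ^ length_B n \<sigma> * x ^ efmaj n \<sigma> * y ^ edes n \<sigma> * z ^ eneg n \<sigma>)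
      = (1 - x * z) ^ card (?E - {0}) * (\<Prod>i\<in>?E - {n}. 1 - y * x ^ i) *
          of_int (if even n then 0 else fact (n div 2))"
    using sum_hyperoctahedral_parity_class[of n ?E 0 "\<lambda>i. y * x ^ i" "x * z"]
      sum_sign_even_positions[of n] assms
    by simp
  show "(\<Sum>\<sigma>\<in>hyperoctahedral n. (-1) ^ length_B n \<sigma> * x ^ efmaj n \<sigma> * y ^ edes n \<sigma> * z ^ eneg n \<sigma>)
      = of_int (par (int n + 1)) * of_nat (fact (n div 2)) * (1 - x * z) ^ (n div 2)
           * (\<Prod>i=0..n div 2. 1 - y * x ^ (2 * i))"
  proof (cases "even n")
    case True
    then have "par (int n + 1) = 0"
      by (simp add: par_def nat_add_distrib)
    with True show ?thesis by (simp add: *)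
  next
    case False
    then have "par (int n + 1) = 1"
      by (simp add: par_def nat_add_distrib)
    moreover have "(\<Prod>i\<in>?E - {n}. 1 - y * x ^ i) = (\<Prod>i=0..n div 2. 1 - y * x ^ (2 * i))"
      by (rule prod.reindex_bij_witness[of _ "\<lambda>j. 2 * j" "\<lambda>i. i div 2"]) (use False in auto)
    ultimately show ?thesis unfolding * using False card_even_le[of n] by (simp add: of_int_fact_eq_of_nat mult_ac del: of_nat_fact)
  qed
qed

end
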